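(* Let $K$ be a commutative ring with identity, let $B$ be a monoid and $n\ge 0$. If $B$ is weak bi-$FP_n$ over $K$, then $B$ is both left-$FP_n$ and right-$FP_n$ over $K$.
   Context: $KB$ denotes the monoid ring, with augmentation $\varepsilon: KB\to K$, $b\mapsto 1$ for $b\in B$. A left (or right) module $M$ over a ring is of type $FP_n$ if there is an exact sequence $0\leftarrow M\leftarrow P_0\leftarrow P_1\leftarrow\cdots\leftarrow P_n$ with $P_0,\dots,P_n$ finitely generated free modules. $B$ is left-$FP_n$ (resp. right-$FP_n$) if $K$, regarded as a left (resp. right) $KB$-module via $a\cdot k=\varepsilon(a)k$ (resp. $k\cdot a=k\varepsilon(a)$), is of type $FP_n$. A $(KB,KB)$-bimodule is an abelian group with commuting left and right $KB$-actions such that $km=mk$ for $k\in K$; the free $(KB,KB)$-bimodule of rank $1$ is $KB\otimes_K KB$ with action $a(u\otimes v)b=au\otimes vb$, and a free bimodule of rank $r$ is a direct sum of $r$ copies of it. $B$ is weak bi-$FP_n$ if $K$, regarded as a $(KB,KB)$-bimodule via $a\cdot k\cdot a'=\varepsilon(a)k\varepsilon(a')$, admits an exact sequence $0\leftarrow K\leftarrow F_0\leftarrow\cdots\leftarrow F_n$ with $F_0,\dots,F_n$ finitely generated free $(KB,KB)$-bimodules. *)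

theory Defs
  imports Main
begin

text \<open>Conventions. The commutative ring K is a type 'k of class comm_ring_1, the monoid B
is a type 'b of class monoid_mult. Elements of the monoid ring KB are finitely supported
functions 'b => 'k. A free module of rank r (over KB, resp. a free (KB,KB)-bimodule of rank r)
is represented concretely as functions nat => X => 'k with every component finitely supported
and all components with index >= r equal to zero; X = 'b for one-sided modules, and
X = 'b \<times> 'b for bimodules (KB \<otimes>_K KB has K-basis b \<otimes> b', i.e. it is K[B \<times> B]).\<close>

definition fsupp :: "('x \<Rightarrow> 'k::zero) \<Rightarrow> bool" where
  "fsupp f \<longleftrightarrow> finite {x. f x \<noteq> 0}"

definition monoid_ring :: "('b \<Rightarrow> 'k::zero) set" where
  "monoid_ring = {f. fsupp f}"

definition mr_mult :: "('b::monoid_mult \<Rightarrow> 'k::comm_ring_1) \<Rightarrow> ('b \<Rightarrow> 'k) \<Rightarrow> 'b \<Rightarrow> 'k" where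
  "mr_mult f g = (\<lambda>c. \<Sum>p\<in>{(a, b). f a \<noteq> 0 \<and> g b \<noteq> 0 \<and> a * b = c}. f (fst p) * g (snd p))"

definition aug :: "('b \<Rightarrow> 'k::comm_ring_1) \<Rightarrow> 'k" where
  "aug f = (\<Sum>a\<in>{a. f a \<noteq> 0}. f a)"

definition free_carrier :: "nat \<Rightarrow> (nat \<Rightarrow> 'x \<Rightarrow> 'k::zero) set" where
  "free_carrier r = {x. (\<forall>i. fsupp (x i)) \<and> (\<forall>i\<ge>r. \<forall>c. x i c = 0)}"

definition fadd :: "(nat \<Rightarrow> 'x \<Rightarrow> 'k::plus) \<Rightarrow> (nat \<Rightarrow> 'x \<Rightarrow> 'k) \<Rightarrow> nat \<Rightarrow> 'x \<Rightarrow> 'k" where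
  "fadd x y = (\<lambda>i c. x i c + y i c)"

definition lact :: "('b::monoid_mult \<Rightarrow> 'k::comm_ring_1) \<Rightarrow> (nat \<Rightarrow> 'b \<Rightarrow> 'k) \<Rightarrow> nat \<Rightarrow> 'b \<Rightarrow> 'k" where
  "lact a x = (\<lambda>i. mr_mult a (x i))"

definition ract :: "(nat \<Rightarrow> 'b::monoid_mult \<Rightarrow> 'k::comm_ring_1) \<Rightarrow> ('b \<Rightarrow> 'k) \<Rightarrow> nat \<Rightarrow> 'b \<Rightarrow> 'k" where
  "ract x a = (\<lambda>i. mr_mult (x i) a)"

text \<open>Left and right actions of KB on free bimodules (KB \<otimes>_K KB)^r = K[B \<times> B]^r:
  a (u \<otimes> v) b = au \<otimes> vb.\<close>
definition blact :: "('b::monoid_mult \<Rightarrow> 'k::comm_ring_1) \<Rightarrow> (nat \<Rightarrow> 'b \<times> 'b \<Rightarrow> 'k) \<Rightarrow> nat \<Rightarrow> 'b \<times> 'b \<Rightarrow> 'k" where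
  "blact a x = (\<lambda>i (c, d). \<Sum>p\<in>{(e, e'). a e \<noteq> 0 \<and> x i (e', d) \<noteq> 0 \<and> e * e' = c}.
                              a (fst p) * x i (snd p, d))"

definition bract :: "(nat \<Rightarrow> ('b::monoid_mult) \<times> 'b \<Rightarrow> 'k::comm_ring_1) \<Rightarrow> ('b \<Rightarrow> 'k) \<Rightarrow> nat \<Rightarrow> 'b \<times> 'b \<Rightarrow> 'k" where
  "bract x a = (\<lambda>i (c, d). \<Sum>p\<in>{(f, f'). x i (c, f) \<noteq> 0 \<and> a f' \<noteq> 0 \<and> f * f' = d}.
                              x i (c, fst p) * a (snd p))"

text \<open>A module structure is encoded by a set Ops of pairs (T, s): T an operator on the free
modules (action by an element of KB on one side) and s the corresponding operator on K
(action through the augmentation). Homomorphisms are additive maps commuting with all T.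
An FP_n resolution: 0 <- K <-eps- P_0 <-d 1- P_1 <- ... <-d n- P_n, exact, P_i free of rank r i.\<close>
definition FPn_resolution ::
  "(((nat \<Rightarrow> 'x \<Rightarrow> 'k::comm_ring_1) \<Rightarrow> (nat \<Rightarrow> 'x \<Rightarrow> 'k)) \<times> ('k \<Rightarrow> 'k)) set \<Rightarrow> nat \<Rightarrow> (nat \<Rightarrow> nat)
    \<Rightarrow> (nat \<Rightarrow> (nat \<Rightarrow> 'x \<Rightarrow> 'k) \<Rightarrow> (nat \<Rightarrow> 'x \<Rightarrow> 'k)) \<Rightarrow> ((nat \<Rightarrow> 'x \<Rightarrow> 'k) \<Rightarrow> 'k) \<Rightarrow> bool" where
  "FPn_resolution Ops n r d eps \<longleftrightarrow>
     (\<forall>x\<in>free_carrier (r 0). \<forall>y\<in>free_carrier (r 0). eps (fadd x y) = eps x + eps y) \<and>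
     (\<forall>(T, s)\<in>Ops. \<forall>x\<in>free_carrier (r 0). eps (T x) = s (eps x)) \<and>
     eps ` free_carrier (r 0) = UNIV \<and>
     (\<forall>i. 1 \<le> i \<and> i \<le> n \<longrightarrow>
        (\<forall>x\<in>free_carrier (r i). d i x \<in> free_carrier (r (i - 1))) \<and>
        (\<forall>x\<in>free_carrier (r i). \<forall>y\<in>free_carrier (r i). d i (fadd x y) = fadd (d i x) (d i y)) \<and>
        (\<forall>(T, s)\<in>Ops. \<forall>x\<in>free_carrier (r i). d i (T x) = T (d i x))) \<and>
     (1 \<le> n \<longrightarrow> {x\<in>free_carrier (r 0). eps x = 0} = d 1 ` free_carrier (r 1)) \<and>
     (\<forall>i. 1 \<le> i \<and> i < n \<longrightarrow>
        {x\<in>free_carrier (r i). d i x = (\<lambda>_ _. 0)} = d (Suc i) ` free_carrier (r (Suc i)))"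

definition left_ops :: "(((nat \<Rightarrow> 'b::monoid_mult \<Rightarrow> 'k::comm_ring_1) \<Rightarrow> (nat \<Rightarrow> 'b \<Rightarrow> 'k)) \<times> ('k \<Rightarrow> 'k)) set" where
  "left_ops = {(lact a, \<lambda>k. aug a * k) | a. a \<in> monoid_ring}"

definition right_ops :: "(((nat \<Rightarrow> 'b::monoid_mult \<Rightarrow> 'k::comm_ring_1) \<Rightarrow> (nat \<Rightarrow> 'b \<Rightarrow> 'k)) \<times> ('k \<Rightarrow> 'k)) set" where
  "right_ops = {(\<lambda>x. ract x a, \<lambda>k. k * aug a) | a. a \<in> monoid_ring}"

definition bi_ops :: "(((nat \<Rightarrow> ('b::monoid_mult) \<times> 'b \<Rightarrow> 'k::comm_ring_1) \<Rightarrow> (nat \<Rightarrow> 'b \<times> 'b \<Rightarrow> 'k)) \<times> ('k \<Rightarrow> 'k)) set" where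
  "bi_ops = {(blact a, \<lambda>k. aug a * k) | a. a \<in> monoid_ring}
          \<union> {(\<lambda>x. bract x a, \<lambda>k. k * aug a) | a. a \<in> monoid_ring}"

definition left_FP :: "'k::comm_ring_1 itself \<Rightarrow> 'b::monoid_mult itself \<Rightarrow> nat \<Rightarrow> bool" where
  "left_FP _ _ n \<longleftrightarrow>
     (\<exists>r d (eps :: (nat \<Rightarrow> 'b \<Rightarrow> 'k) \<Rightarrow> 'k). FPn_resolution left_ops n r d eps)"

definition right_FP :: "'k::comm_ring_1 itself \<Rightarrow> 'b::monoid_mult itself \<Rightarrow> nat \<Rightarrow> bool" where
  "right_FP _ _ n \<longleftrightarrow>
     (\<exists>r d (eps :: (nat \<Rightarrow> 'b \<Rightarrow> 'k) \<Rightarrow> 'k). FPn_resolution right_ops n r d eps)"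

definition weak_bi_FP :: "'k::comm_ring_1 itself \<Rightarrow> 'b::monoid_mult itself \<Rightarrow> nat \<Rightarrow> bool" where
  "weak_bi_FP _ _ n \<longleftrightarrow>
     (\<exists>r d (eps :: (nat \<Rightarrow> 'b \<times> 'b \<Rightarrow> 'k) \<Rightarrow> 'k). FPn_resolution bi_ops n r d eps)"

end

theory Submission
  imports Defs "HOL-Library.Function_Algebras"
begin

text \<open>
  Let \<open>F\<close> be the given bimodule resolution. Tensoring it with \<open>K\<close> on the right gives free left
  modules \<open>C\<^sub>i\<close> of finite rank, but the complex \<open>C\<close> is not exact: its homology is
  \<open>Tor(K, K)\<close>. A left resolution \<open>G\<close> is, however, a homotopy retract of \<open>C\<close>: there are a left linear
  chain map \<open>f : G \<rightarrow> F\<close>, because \<open>G\<close> is free and \<open>F\<close> is exact, and a chain map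
  \<open>F \<rightarrow> C \<rightarrow> G\<close>, and the composite \<open>G \<rightarrow> F \<rightarrow> G\<close> lifts the identity of \<open>K\<close>.

  This is turned into a construction of \<open>G\<close> degree by degree. Put \<open>G\<^sub>0 = C\<^sub>0\<close> and
  \<open>G\<^bsub>m+1\<^esub> = C\<^bsub>m+1\<^esub> \<oplus> G\<^sub>m\<close>, with the projection \<open>\<pi> : F\<^sub>m \<rightarrow> C\<^sub>m \<subseteq> G\<^sub>m\<close> as comparison map. With
  \<open>\<phi> : G\<^sub>m \<rightarrow> Z\<^sub>m(G)\<close> a left linear map satisfying \<open>\<phi> z = z - \<pi> f z\<close> on cycles, the differential
  is \<open>d (\<pi> u, x) = \<pi> d u + \<phi> x\<close>. It is onto \<open>Z\<^sub>m(G)\<close>: for a cycle \<open>z\<close>, \<open>f z\<close> is a cycle of \<open>F\<close>,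
  so \<open>f z = d u\<close> and \<open>z = d (\<pi> u, z)\<close>. The next \<open>\<phi>\<close> is \<open>y \<mapsto> y - \<pi> f y - (0, d y)\<close>.

  The right-handed statement is the left-handed one for the opposite monoid.
\<close>

section \<open>The monoid ring\<close>

lemma fun_sum_apply: "(\<Sum>i\<in>A. f i) x = (\<Sum>i\<in>A. f i x)"
  for f :: "'i \<Rightarrow> 'x \<Rightarrow> 'k::comm_monoid_add"
  by (induction A rule: infinite_finite_induct) auto

lemma fsupp_mono:
  assumes "finite A" "\<And>x. f x \<noteq> 0 \<Longrightarrow> x \<in> A"
  shows "fsupp f"
  unfolding fsupp_def by (rule finite_subset[OF _ assms(1)]) (use assms(2) in auto)

lemma fsupp_zero [simp]: "fsupp (\<lambda>_. 0)" "fsupp 0"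
  by (auto simp: fsupp_def)

lemma fsupp_add: "fsupp f \<Longrightarrow> fsupp g \<Longrightarrow> fsupp (f + g)" for f g :: "'x \<Rightarrow> 'k::comm_ring_1"
  unfolding fsupp_def by (rule finite_subset[of _ "{x. f x \<noteq> 0} \<union> {x. g x \<noteq> 0}"]) auto

lemma fsupp_diff: "fsupp f \<Longrightarrow> fsupp g \<Longrightarrow> fsupp (f - g)" for f g :: "'x \<Rightarrow> 'k::comm_ring_1"
  unfolding fsupp_def by (rule finite_subset[of _ "{x. f x \<noteq> 0} \<union> {x. g x \<noteq> 0}"]) auto

lemma sum_rotate:
  fixes t :: "'x \<Rightarrow> 'y \<Rightarrow> 'z \<Rightarrow> 'm::comm_monoid_add"
  shows "(\<Sum>x\<in>X. \<Sum>y\<in>Y. \<Sum>z\<in>Z. t x y z) = (\<Sum>y\<in>Y. \<Sum>z\<in>Z. \<Sum>x\<in>X. t x y z)"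
  by (rule trans[OF sum.swap]) (rule sum.cong[OF refl sum.swap])

text \<open>The index set in \<open>mr_mult\<close> depends on the exact supports. Any finite
  rectangle containing the supports gives the same value, since the additional terms vanish;
  products of different functions can then be compared over one common index set.\<close>

lemma mr_mult_eq_sum:
  fixes f g :: "'b::monoid_mult \<Rightarrow> 'k::comm_ring_1"
  assumes "finite S" "finite T" "{a. f a \<noteq> 0} \<subseteq> S" "{b. g b \<noteq> 0} \<subseteq> T"
  shows "mr_mult f g c = (\<Sum>a\<in>S. \<Sum>b\<in>T. if a * b = c then f a * g b else 0)"
proof -
  have "mr_mult f g c = (\<Sum>p\<in>S \<times> T. if fst p * snd p = c then f (fst p) * g (snd p) else 0)"
    unfolding mr_mult_def using assms
    by (intro sum.mono_neutral_cong_left) (auto split: if_splits)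
  also have "\<dots> = (\<Sum>a\<in>S. \<Sum>b\<in>T. if a * b = c then f a * g b else 0)"
    by (simp add: sum.cartesian_product case_prod_unfold)
  finally show ?thesis .
qed

lemma aug_eq_sum:
  assumes "finite S" "{a. f a \<noteq> 0} \<subseteq> S"
  shows "aug f = sum f S"
  unfolding aug_def using assms by (intro sum.mono_neutral_left) auto

lemma aug_nonzeroD: "aug f \<noteq> 0 \<Longrightarrow> \<exists>a. f a \<noteq> 0"
  unfolding aug_def by (metis (mono_tags, lifting) sum.neutral)

lemma mr_mult_nonzeroD:
  assumes "mr_mult f g c \<noteq> 0"
  obtains a b where "f a \<noteq> 0" "g b \<noteq> 0" "c = a * b"
proof -
  obtain p where "p \<in> {(a, b). f a \<noteq> 0 \<and> g b \<noteq> 0 \<and> a * b = c}"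
    using assms unfolding mr_mult_def by (rule sum.not_neutral_contains_not_neutral)
  then show ?thesis using that by auto
qed

lemma fsupp_mr_mult:
  assumes "fsupp f" "fsupp g"
  shows "fsupp (mr_mult f g)"
proof (rule fsupp_mono)
  show "finite ((\<lambda>(a, b). a * b) ` ({a. f a \<noteq> 0} \<times> {b. g b \<noteq> 0}))"
    using assms by (auto simp: fsupp_def)
qed (auto elim!: mr_mult_nonzeroD)

lemma mr_mult_zero [simp]: "mr_mult 0 g = 0" "mr_mult f 0 = 0"
    "mr_mult (\<lambda>_. 0) g = 0" "mr_mult f (\<lambda>_. 0) = 0"
  by (auto simp: mr_mult_def fun_eq_iff)

lemma mr_mult_add_left:
  assumes "fsupp f" "fsupp f'" "fsupp g"
  shows "mr_mult (f + f') g = mr_mult f g + mr_mult f' g"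
proof
  fix c
  let ?S = "{a. f a \<noteq> 0} \<union> {a. f' a \<noteq> 0}" and ?T = "{b. g b \<noteq> 0}"
  have "finite ?S" "finite ?T" using assms by (auto simp: fsupp_def)
  note * = mr_mult_eq_sum[OF this, of _ g c]
  have "mr_mult f g c + mr_mult f' g c =
      (\<Sum>a\<in>?S. \<Sum>b\<in>?T. if a * b = c then f a * g b else 0)
      + (\<Sum>a\<in>?S. \<Sum>b\<in>?T. if a * b = c then f' a * g b else 0)"
    by (subst (1 2) *) auto
  also have "\<dots> = (\<Sum>a\<in>?S. \<Sum>b\<in>?T. if a * b = c then (f + f') a * g b else 0)"
    unfolding sum.distrib[symmetric] by (intro sum.cong refl) (auto simp: algebra_simps)
  also have "\<dots> = mr_mult (f + f') g c"
    by (subst *) auto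
  finally show "mr_mult (f + f') g c = (mr_mult f g + mr_mult f' g) c" by simp
qed

lemma mr_mult_add_right:
  assumes "fsupp f" "fsupp g" "fsupp g'"
  shows "mr_mult f (g + g') = mr_mult f g + mr_mult f g'"
proof
  fix c
  let ?T = "{a. g a \<noteq> 0} \<union> {a. g' a \<noteq> 0}" and ?S = "{b. f b \<noteq> 0}"
  have "finite ?S" "finite ?T" using assms by (auto simp: fsupp_def)
  note * = mr_mult_eq_sum[OF this, of f _ c]
  have "mr_mult f g c + mr_mult f g' c =
      (\<Sum>a\<in>?S. \<Sum>b\<in>?T. if a * b = c then f a * g b else 0)
      + (\<Sum>a\<in>?S. \<Sum>b\<in>?T. if a * b = c then f a * g' b else 0)"
    by (subst (1 2) *) auto
  also have "\<dots> = (\<Sum>a\<in>?S. \<Sum>b\<in>?T. if a * b = c then f a * (g + g') b else 0)"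
    unfolding sum.distrib[symmetric] by (intro sum.cong refl) (auto simp: algebra_simps)
  also have "\<dots> = mr_mult f (g + g') c"
    by (subst *) auto
  finally show "mr_mult f (g + g') c = (mr_mult f g + mr_mult f g') c" by simp
qed

text \<open>Both sides equal the triple sum of \<open>f a * g b * h z\<close> over
  \<open>a * b * z = c\<close>. The sets \<open>?FG\<close> and \<open>?GH\<close> contain the
  supports of the inner products, so the intermediate factor, \<open>a * b\<close> or
  \<open>b * z\<close>, can be inserted and removed as a delta sum.\<close>

lemma mr_mult_assoc:
  assumes "fsupp f" "fsupp g" "fsupp h"
  shows "mr_mult (mr_mult f g) h = mr_mult f (mr_mult g h)"
proof
  fix c
  let ?F = "{a. f a \<noteq> 0}" and ?G = "{a. g a \<noteq> 0}" and ?H = "{a. h a \<noteq> 0}"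
  let ?FG = "(\<lambda>(a, b). a * b) ` (?F \<times> ?G)" and ?GH = "(\<lambda>(a, b). a * b) ` (?G \<times> ?H)"
  have fin: "finite ?F" "finite ?G" "finite ?H" "finite ?FG" "finite ?GH"
    using assms by (auto simp: fsupp_def)
  have sub: "{x. mr_mult f g x \<noteq> 0} \<subseteq> ?FG" "{x. mr_mult g h x \<noteq> 0} \<subseteq> ?GH"
    by (auto elim!: mr_mult_nonzeroD)
  have "mr_mult (mr_mult f g) h c
      = (\<Sum>x\<in>?FG. \<Sum>z\<in>?H. if x * z = c then mr_mult f g x * h z else 0)"
    using fin sub by (intro mr_mult_eq_sum) auto
  also have "\<dots> = (\<Sum>x\<in>?FG. \<Sum>z\<in>?H. \<Sum>a\<in>?F. \<Sum>b\<in>?G.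
      if a * b = x then if x * z = c then f a * g b * h z else 0 else 0)"
  proof (intro sum.cong refl)
    fix x z
    show "(if x * z = c then mr_mult f g x * h z else 0) = (\<Sum>a\<in>?F. \<Sum>b\<in>?G.
        if a * b = x then if x * z = c then f a * g b * h z else 0 else 0)"
      by (cases "x * z = c")
         (auto simp: mr_mult_eq_sum[OF fin(1,2)] sum_distrib_right intro!: sum.cong sum.neutral)
  qed
  also have "\<dots> = (\<Sum>a\<in>?F. \<Sum>b\<in>?G. \<Sum>z\<in>?H. \<Sum>x\<in>?FG.
      if a * b = x then if x * z = c then f a * g b * h z else 0 else 0)"
    by (rule trans[OF sum_rotate], rule trans[OF sum.cong[OF refl sum.cong[OF refl sum.swap]]],
        rule sum_rotate)
  also have "\<dots> = (\<Sum>a\<in>?F. \<Sum>b\<in>?G. \<Sum>z\<in>?H. if a * b * z = c then f a * g b * h z else 0)"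
    using fin by (intro sum.cong refl) (subst sum.delta', auto)
  also have "\<dots> = (\<Sum>a\<in>?F. \<Sum>b\<in>?G. \<Sum>z\<in>?H. \<Sum>y\<in>?GH.
      if b * z = y then if a * y = c then f a * g b * h z else 0 else 0)"
    using fin by (intro sum.cong refl) (subst sum.delta', auto simp: mult.assoc)
  also have "\<dots> = (\<Sum>a\<in>?F. \<Sum>y\<in>?GH. \<Sum>b\<in>?G. \<Sum>z\<in>?H.
      if b * z = y then if a * y = c then f a * g b * h z else 0 else 0)"
    by (rule sum.cong[OF refl sum_rotate[symmetric]])
  also have "\<dots> = (\<Sum>a\<in>?F. \<Sum>y\<in>?GH. if a * y = c then f a * mr_mult g h y else 0)"
  proof (intro sum.cong refl)
    fix a y
    show "(\<Sum>b\<in>?G. \<Sum>z\<in>?H. if b * z = y then if a * y = c then f a * g b * h z else 0 else 0)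
        = (if a * y = c then f a * mr_mult g h y else 0)"
      by (cases "a * y = c")
         (auto simp: mr_mult_eq_sum[OF fin(2,3)] sum_distrib_left mult.assoc intro!: sum.cong sum.neutral)
  qed
  also have "\<dots> = mr_mult f (mr_mult g h) c"
    using fin sub by (intro mr_mult_eq_sum[symmetric]) auto
  finally show "mr_mult (mr_mult f g) h c = mr_mult f (mr_mult g h) c" .
qed

section \<open>Monoid elements inside the monoid ring\<close>

definition single :: "'b \<Rightarrow> 'b \<Rightarrow> 'k::comm_ring_1" where
  "single b = (\<lambda>c. if c = b then 1 else 0)"

lemma fsupp_single [simp]: "fsupp (single b)"
  by (rule fsupp_mono[of "{b}"]) (auto simp: single_def split: if_splits)

lemma aug_single [simp]: "aug (single b :: 'b \<Rightarrow> 'k::comm_ring_1) = 1"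
  by (subst aug_eq_sum[of "{b}"]) (auto simp: single_def)

lemma mr_mult_single_right:
  assumes "fsupp f"
  shows "mr_mult f (single b) c = (\<Sum>a\<in>{a. f a \<noteq> 0}. if a * b = c then f a else 0)"
proof (subst mr_mult_eq_sum[of "{a. f a \<noteq> 0}" "{b}"])
qed (use assms in \<open>auto simp: fsupp_def single_def intro!: sum.cong\<close>)

lemma mr_mult_one_right: "fsupp f \<Longrightarrow> mr_mult f (single 1) = f"
  by (rule ext) (auto simp: mr_mult_single_right fsupp_def sum.delta')

lemma mr_mult_single_single:
  "mr_mult (\<lambda>a. if a = b then k else 0) (single c) = (\<lambda>d. if d = b * c then k else 0)"
  by (rule ext, subst mr_mult_eq_sum[of "{b}" "{c}"]) (auto simp: single_def)

text \<open>Each pair \<open>(a, b)\<close> contributes to exactly one coefficient, the one at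
  \<open>a * b\<close>; summing over all coefficients therefore removes the condition
  \<open>a * b = c\<close> and leaves a product of sums.\<close>

lemma aug_mr_mult:
  assumes "fsupp f" "fsupp g"
  shows "aug (mr_mult f g) = aug f * aug g"
proof -
  let ?F = "{a. f a \<noteq> 0}" and ?G = "{a. g a \<noteq> 0}"
  let ?S = "(\<lambda>(a, b). a * b) ` (?F \<times> ?G)"
  have fin: "finite ?F" "finite ?G" "finite ?S" using assms by (auto simp: fsupp_def)
  have "aug (mr_mult f g) = (\<Sum>c\<in>?S. \<Sum>a\<in>?F. \<Sum>b\<in>?G. if a * b = c then f a * g b else 0)"
    using fin by (subst aug_eq_sum[of ?S])
      (auto elim!: mr_mult_nonzeroD simp flip: mr_mult_eq_sum[of ?F ?G])
  also have "\<dots> = (\<Sum>a\<in>?F. \<Sum>b\<in>?G. \<Sum>c\<in>?S. if a * b = c then f a * g b else 0)"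
    by (rule sum_rotate)
  also have "\<dots> = (\<Sum>a\<in>?F. \<Sum>b\<in>?G. f a * g b)"
    using fin by (intro sum.cong refl) (subst sum.delta', auto)
  also have "\<dots> = aug f * aug g" by (simp add: aug_def sum_product)
  finally show ?thesis .
qed

lemma aug_add: "fsupp f \<Longrightarrow> fsupp g \<Longrightarrow> aug (f + g) = aug f + aug g"
  for f g :: "'b \<Rightarrow> 'k::comm_ring_1"
  by (subst (1 2 3) aug_eq_sum[of "{x. f x \<noteq> 0} \<union> {x. g x \<noteq> 0}"])
     (auto simp: fsupp_def sum.distrib)

section \<open>Free modules and free bimodules\<close>

lemma fadd_eq: "fadd x y = x + y"
  by (simp add: fadd_def fun_eq_iff)

lemma free_carrier_iff:
  "x \<in> free_carrier r \<longleftrightarrow> (\<forall>i. fsupp (x i)) \<and> (\<forall>i\<ge>r. x i = 0)"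
  by (auto simp: free_carrier_def fun_eq_iff)

lemma free_carrier_add: "x \<in> free_carrier r \<Longrightarrow> y \<in> free_carrier r \<Longrightarrow> x + y \<in> free_carrier r"
  for x y :: "nat \<Rightarrow> 'x \<Rightarrow> 'k::comm_ring_1"
  by (auto simp: free_carrier_iff fsupp_add)

lemma free_carrier_diff: "x \<in> free_carrier r \<Longrightarrow> y \<in> free_carrier r \<Longrightarrow> x - y \<in> free_carrier r"
  for x y :: "nat \<Rightarrow> 'x \<Rightarrow> 'k::comm_ring_1"
  by (auto simp: free_carrier_iff fsupp_diff)

lemma free_carrier_zero [simp]: "0 \<in> free_carrier r"
  by (auto simp: free_carrier_iff)

lemma free_carrier_sum:
  "(\<And>i. i \<in> A \<Longrightarrow> f i \<in> free_carrier r) \<Longrightarrow> (\<Sum>i\<in>A. f i) \<in> free_carrier r"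
  for f :: "'i \<Rightarrow> nat \<Rightarrow> 'x \<Rightarrow> 'k::comm_ring_1"
  by (induction A rule: infinite_finite_induct) (auto intro: free_carrier_add)

lemma free_carrier_mono: "r \<le> s \<Longrightarrow> free_carrier r \<subseteq> free_carrier s"
  by (auto simp: free_carrier_iff)

text \<open>Common interface of the left actions on free left modules and on free bimodules: lifting
  along a surjection needs the second as target and the first as source. The rank \<open>r\<close>
  varies within one instance, because the action does not depend on it.\<close>

locale monoid_ring_action =
  fixes act :: "('b::monoid_mult \<Rightarrow> 'k::comm_ring_1) \<Rightarrow> (nat \<Rightarrow> 'x \<Rightarrow> 'k) \<Rightarrow> nat \<Rightarrow> 'x \<Rightarrow> 'k"
  assumes closed: "fsupp a \<Longrightarrow> x \<in> free_carrier r \<Longrightarrow> act a x \<in> free_carrier r"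
    and add_right: "fsupp a \<Longrightarrow> x \<in> free_carrier r \<Longrightarrow> y \<in> free_carrier r
        \<Longrightarrow> act a (x + y) = act a x + act a y"
    and add_left: "fsupp a \<Longrightarrow> fsupp b \<Longrightarrow> x \<in> free_carrier r
        \<Longrightarrow> act (a + b) x = act a x + act b x"
    and assoc: "fsupp a \<Longrightarrow> fsupp b \<Longrightarrow> x \<in> free_carrier r
        \<Longrightarrow> act (mr_mult a b) x = act a (act b x)"
begin

lemma zero_right: "fsupp a \<Longrightarrow> act a 0 = 0"
  using add_right[of a 0 0 0] by simp

lemma diff_right:
  assumes "fsupp a" "x \<in> free_carrier r" "y \<in> free_carrier r"
  shows "act a (x - y) = act a x - act a y"
  using add_right[OF assms(1) free_carrier_diff[OF assms(2,3)] assms(3)] by (simp add: algebra_simps)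

lemma sum_right:
  assumes "fsupp a" "\<And>i. i \<in> A \<Longrightarrow> f i \<in> free_carrier r"
  shows "act a (\<Sum>i\<in>A. f i) = (\<Sum>i\<in>A. act a (f i))"
  using assms(2)
proof (induction A rule: infinite_finite_induct)
  case (insert i A)
  have "act a (f i + sum f A) = act a (f i) + (\<Sum>j\<in>A. act a (f j))"
    using add_right[OF assms(1), of "f i" r "sum f A"] free_carrier_sum[of A f r] insert by simp
  then show ?case
    unfolding sum.insert[OF insert(1,2)] .
qed (auto simp: zero_right[OF assms(1)])

end

interpretation lact: monoid_ring_action "lact :: ('b::monoid_mult \<Rightarrow> 'k::comm_ring_1) \<Rightarrow> _"
proof
  fix a b :: "'b::monoid_mult \<Rightarrow> 'k::comm_ring_1" and x y :: "nat \<Rightarrow> 'b \<Rightarrow> 'k" and r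
  assume a: "fsupp a" and x: "x \<in> free_carrier r"
  show "lact a x \<in> free_carrier r"
    using a x by (auto simp: free_carrier_iff lact_def fsupp_mr_mult)
  show "lact a (x + y) = lact a x + lact a y" if "y \<in> free_carrier r"
    using a x that by (auto simp: free_carrier_iff lact_def mr_mult_add_right fun_eq_iff)
  show "lact (a + b) x = lact a x + lact b x" if "fsupp b"
    using a x that by (auto simp: free_carrier_iff lact_def mr_mult_add_left fun_eq_iff)
  show "lact (mr_mult a b) x = lact a (lact b x)" if "fsupp b"
    using a x that by (auto simp: free_carrier_iff lact_def mr_mult_assoc fun_eq_iff)
qed

text \<open>With the right coordinate fixed, the left action is multiplication in the monoid ring.
  The action laws for bimodules follow slice by slice from those of \<open>mr_mult\<close>.\<close>

lemma blact_apply: "blact a x i (c, d) = mr_mult a (\<lambda>e. x i (e, d)) c"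
  by (simp add: blact_def mr_mult_def)

lemma bract_apply: "bract x a i (c, d) = mr_mult (\<lambda>e. x i (c, e)) a d"
  by (simp add: bract_def mr_mult_def)

lemma fsupp_slice:
  assumes "fsupp f"
  shows "fsupp (\<lambda>e. f (e, d))" "fsupp (\<lambda>e. f (c, e))"
  using assms finite_vimageI[of "{p. f p \<noteq> 0}" "\<lambda>e. (e, d)"]
    finite_vimageI[of "{p. f p \<noteq> 0}" "\<lambda>e. (c, e)"]
  by (auto simp: fsupp_def vimage_def inj_on_def)

interpretation blact: monoid_ring_action "blact :: ('b::monoid_mult \<Rightarrow> 'k::comm_ring_1) \<Rightarrow> _"
proof
  fix a b :: "'b::monoid_mult \<Rightarrow> 'k::comm_ring_1" and x y :: "nat \<Rightarrow> 'b \<times> 'b \<Rightarrow> 'k" and r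
  assume a: "fsupp a" and x: "x \<in> free_carrier r"
  have sl: "fsupp (\<lambda>e. z i (e, d))" if "z \<in> free_carrier r" for z :: "nat \<Rightarrow> 'b \<times> 'b \<Rightarrow> 'k" and i d
    using that by (auto simp: free_carrier_iff intro: fsupp_slice)
  have "fsupp (blact a x i)" for i
  proof (rule fsupp_mono)
    show "finite ((\<lambda>(e, e', d). (e * e', d)) ` ({e. a e \<noteq> 0} \<times> {p. x i p \<noteq> 0}))"
      using a x by (auto simp: fsupp_def free_carrier_iff)
    show "p \<in> (\<lambda>(e, e', d). (e * e', d)) ` ({e. a e \<noteq> 0} \<times> {p. x i p \<noteq> 0})"
      if "blact a x i p \<noteq> 0" for p
      using that by (cases p) (force simp: blact_apply elim!: mr_mult_nonzeroD)
  qed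
  then show "blact a x \<in> free_carrier r"
    using x by (auto simp: free_carrier_iff blact_apply fun_eq_iff)
  show "blact a (x + y) = blact a x + blact a y" if "y \<in> free_carrier r"
    using mr_mult_add_right[OF a sl[OF x] sl[OF that]]
    by (auto simp: blact_apply fun_eq_iff plus_fun_def)
  show "blact (a + b) x = blact a x + blact b x" if "fsupp b"
    using a sl[OF x] that by (auto simp: blact_apply mr_mult_add_left fun_eq_iff)
  show "blact (mr_mult a b) x = blact a (blact b x)" if "fsupp b"
    using a sl[OF x] that by (auto simp: blact_apply mr_mult_assoc fun_eq_iff)
qed

section \<open>Homomorphisms between free modules\<close>

text \<open>Source and target may have different basis types, so left linear maps between left
  modules and bimodules are covered in both directions.\<close>

definition module_hom ::
  "(('b \<Rightarrow> 'k::comm_ring_1) \<Rightarrow> (nat \<Rightarrow> 'x \<Rightarrow> 'k) \<Rightarrow> nat \<Rightarrow> 'x \<Rightarrow> 'k)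
    \<Rightarrow> (('b \<Rightarrow> 'k) \<Rightarrow> (nat \<Rightarrow> 'y \<Rightarrow> 'k) \<Rightarrow> nat \<Rightarrow> 'y \<Rightarrow> 'k)
    \<Rightarrow> nat \<Rightarrow> nat \<Rightarrow> ((nat \<Rightarrow> 'x \<Rightarrow> 'k) \<Rightarrow> nat \<Rightarrow> 'y \<Rightarrow> 'k) \<Rightarrow> bool" where
  "module_hom act act' r s f \<longleftrightarrow>
     (\<forall>x\<in>free_carrier r. f x \<in> free_carrier s) \<and>
     (\<forall>x\<in>free_carrier r. \<forall>y\<in>free_carrier r. f (x + y) = f x + f y) \<and>
     (\<forall>a. fsupp a \<longrightarrow> (\<forall>x\<in>free_carrier r. f (act a x) = act' a (f x)))"

lemma module_homD:
  assumes "module_hom act act' r s f" "x \<in> free_carrier r"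
  shows "f x \<in> free_carrier s" "y \<in> free_carrier r \<Longrightarrow> f (x + y) = f x + f y"
    "fsupp a \<Longrightarrow> f (act a x) = act' a (f x)"
  using assms by (auto simp: module_hom_def)

text \<open>The target is an arbitrary abelian group, so that this and the next two facts apply to
  augmentations with values in \<open>K\<close> as well as to maps between free modules.\<close>

lemma additive_zero:
  fixes f :: "(nat \<Rightarrow> 'x \<Rightarrow> 'k::comm_ring_1) \<Rightarrow> 'm::ab_group_add"
  assumes "\<forall>x\<in>free_carrier r. \<forall>y\<in>free_carrier r. f (x + y) = f x + f y"
  shows "f 0 = 0"
  using assms[rule_format, of 0 0] by simp

lemma additive_diff:
  fixes f :: "(nat \<Rightarrow> 'x \<Rightarrow> 'k::comm_ring_1) \<Rightarrow> 'm::ab_group_add"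
  assumes "\<forall>x\<in>free_carrier r. \<forall>y\<in>free_carrier r. f (x + y) = f x + f y"
    "x \<in> free_carrier r" "y \<in> free_carrier r"
  shows "f (x - y) = f x - f y"
  using assms(1)[rule_format, OF free_carrier_diff[OF assms(2,3)] assms(3)]
  by (simp add: algebra_simps)

lemma additive_sum:
  fixes f :: "(nat \<Rightarrow> 'x \<Rightarrow> 'k::comm_ring_1) \<Rightarrow> 'm::ab_group_add"
  assumes add: "\<forall>x\<in>free_carrier r. \<forall>y\<in>free_carrier r. f (x + y) = f x + f y"
    and "\<And>i. i \<in> A \<Longrightarrow> g i \<in> free_carrier r"
  shows "f (\<Sum>i\<in>A. g i) = (\<Sum>i\<in>A. f (g i))"
  using assms(2)
proof (induction A rule: infinite_finite_induct)
  case (insert i A)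
  have "f (g i + sum g A) = f (g i) + (\<Sum>j\<in>A. f (g j))"
    using add free_carrier_sum[of A g r] insert by simp
  then show ?case
    unfolding sum.insert[OF insert(1,2)] .
qed (auto simp: additive_zero[OF add])

lemma module_hom_additive:
  "module_hom act act' r s f \<Longrightarrow> \<forall>x\<in>free_carrier r. \<forall>y\<in>free_carrier r. f (x + y) = f x + f y"
  by (simp add: module_hom_def)

lemma module_hom_zero: "module_hom act act' r s f \<Longrightarrow> f 0 = 0"
  by (rule additive_zero[of r]) (rule module_hom_additive)

lemma module_hom_diff:
  "module_hom act act' r s f \<Longrightarrow> x \<in> free_carrier r \<Longrightarrow> y \<in> free_carrier r
    \<Longrightarrow> f (x - y) = f x - f y"
  using additive_diff[of r f x y] module_hom_additive[of act act' r s f] by metis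

lemma module_hom_sum:
  "module_hom act act' r s f \<Longrightarrow> (\<And>i. i \<in> A \<Longrightarrow> g i \<in> free_carrier r)
    \<Longrightarrow> f (\<Sum>i\<in>A. g i) = (\<Sum>i\<in>A. f (g i))"
  using additive_sum[of r f A g] module_hom_additive[of act act' r s f] by metis

lemma module_hom_comp:
  "module_hom act act' r s f \<Longrightarrow> module_hom act' act'' s t g
    \<Longrightarrow> module_hom act act'' r t (\<lambda>x. g (f x))"
  by (simp add: module_hom_def)

lemma module_hom_id: "r \<le> s \<Longrightarrow> module_hom act act r s (\<lambda>x. x)"
  using free_carrier_mono[of r s] by (auto simp: module_hom_def)

lemma module_hom_mono: "module_hom act act' r s f \<Longrightarrow> s \<le> t \<Longrightarrow> module_hom act act' r t f"
  using module_hom_comp[OF _ module_hom_id] .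

lemma module_hom_plus:
  assumes "monoid_ring_action act'" "module_hom act act' r s f" "module_hom act act' r s g"
  shows "module_hom act act' r s (\<lambda>x. f x + g x)"
  using assms(2,3) monoid_ring_action.add_right[OF assms(1)]
  by (auto simp: module_hom_def free_carrier_add algebra_simps)

lemma module_hom_minus:
  assumes "monoid_ring_action act'" "module_hom act act' r s f" "module_hom act act' r s g"
  shows "module_hom act act' r s (\<lambda>x. f x - g x)"
  using assms(2,3) monoid_ring_action.diff_right[OF assms(1)]
  by (auto simp: module_hom_def free_carrier_diff algebra_simps)

definition basis_vec :: "nat \<Rightarrow> nat \<Rightarrow> 'b::monoid_mult \<Rightarrow> 'k::comm_ring_1" where
  "basis_vec i = (\<lambda>j. if j = i then single 1 else 0)"

lemma basis_vec_free_carrier: "i < s \<Longrightarrow> basis_vec i \<in> free_carrier s"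
  by (auto simp: basis_vec_def free_carrier_iff)

lemma free_expansion:
  assumes "x \<in> free_carrier s"
  shows "x = (\<Sum>i<s. lact (x i) (basis_vec i))"
proof
  fix j
  have "(\<Sum>i<s. lact (x i) (basis_vec i)) j = (\<Sum>i<s. if j = i then x i else 0)"
    unfolding fun_sum_apply[where x = j]
    by (intro sum.cong refl)
       (use assms in \<open>auto simp: lact_def basis_vec_def free_carrier_iff mr_mult_one_right\<close>)
  also have "\<dots> = x j"
    using assms by (auto simp: free_carrier_iff)
  finally show "x j = (\<Sum>i<s. lact (x i) (basis_vec i)) j" by simp
qed

text \<open>Free modules are projective: choose preimages under \<open>d\<close> of the images of
  the basis vectors and extend linearly. Agreement with \<psi> follows from the basis
  expansion.\<close>

lemma module_hom_lift:
  fixes \<psi> :: "(nat \<Rightarrow> 'b::monoid_mult \<Rightarrow> 'k::comm_ring_1) \<Rightarrow> nat \<Rightarrow> 'x \<Rightarrow> 'k"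
  assumes act: "monoid_ring_action act"
    and \<psi>: "module_hom lact act s t \<psi>" and d: "module_hom act act r t d"
    and im: "\<And>x. x \<in> free_carrier s \<Longrightarrow> \<psi> x \<in> d ` free_carrier r"
  obtains f where "module_hom lact act s r f" "\<And>x. x \<in> free_carrier s \<Longrightarrow> d (f x) = \<psi> x"
proof -
  interpret monoid_ring_action act by fact
  \<comment> \<open>The bound sits inside the existential so that a total choice function
    \<open>w\<close> can be extracted.\<close>
  have "\<exists>w. i < s \<longrightarrow> w \<in> free_carrier r \<and> d w = \<psi> (basis_vec i)" for i
    using im[OF basis_vec_free_carrier[of i s]] by (cases "i < s") (auto simp: image_iff)
  then obtain w where w: "\<And>i. i < s \<Longrightarrow> w i \<in> free_carrier r"
      "\<And>i. i < s \<Longrightarrow> d (w i) = \<psi> (basis_vec i)" by metis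
  define f where "f x = (\<Sum>i<s. act (x i) (w i))" for x
  have fs: "fsupp (x i)" if "x \<in> free_carrier s" for x :: "nat \<Rightarrow> 'b \<Rightarrow> 'k" and i
    using that by (simp add: free_carrier_iff)
  have "module_hom lact act s r f"
    unfolding module_hom_def
  proof (intro conjI ballI allI impI)
    fix x :: "nat \<Rightarrow> 'b \<Rightarrow> 'k" assume x: "x \<in> free_carrier s"
    show "f x \<in> free_carrier r"
      unfolding f_def using w fs[OF x] by (auto intro!: free_carrier_sum closed)
    show "f (x + y) = f x + f y" if "y \<in> free_carrier s" for y
      unfolding f_def sum.distrib[symmetric] using w fs[OF x] fs[OF that]
      by (auto intro!: sum.cong add_left)
    show "f (lact a x) = act a (f x)" if "fsupp a" for a
      unfolding f_def using that w fs[OF x]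
      by (subst sum_right[where r = r])
         (auto simp: lact_def intro!: sum.cong assoc closed)
  qed
  moreover have "d (f x) = \<psi> x" if x: "x \<in> free_carrier s" for x
  proof -
    have "d (f x) = (\<Sum>i<s. act (x i) (d (w i)))"
      unfolding f_def using w fs[OF x] d
      by (subst module_hom_sum[OF d]) (auto simp: module_homD intro!: sum.cong closed)
    also have "\<dots> = (\<Sum>i<s. \<psi> (lact (x i) (basis_vec i)))"
      using w(2) fs[OF x] by (auto simp: module_homD(3)[OF \<psi> basis_vec_free_carrier] intro!: sum.cong)
    also have "\<dots> = \<psi> (\<Sum>i<s. lact (x i) (basis_vec i))"
      using fs[OF x] by (subst module_hom_sum[OF \<psi>]) (auto intro!: lact.closed basis_vec_free_carrier)
    finally show ?thesis using free_expansion[OF x] by simp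
  qed
  ultimately show ?thesis using that by blast
qed

section \<open>Collapsing the right action\<close>

text \<open>The map x \<mapsto> x \<otimes> 1, a left linear section of
  \<open>collapse\<close>.\<close>

definition tensor_one :: "(nat \<Rightarrow> 'b::monoid_mult \<Rightarrow> 'k::comm_ring_1) \<Rightarrow> nat \<Rightarrow> 'b \<times> 'b \<Rightarrow> 'k" where
  "tensor_one x = (\<lambda>i (c, d). if d = 1 then x i c else 0)"

text \<open>The map \<open>F \<rightarrow> F \<otimes>\<^bsub>KB\<^esub> K\<close> for a free bimodule \<open>F\<close>.\<close>

definition collapse :: "(nat \<Rightarrow> 'b::monoid_mult \<times> 'b \<Rightarrow> 'k::comm_ring_1) \<Rightarrow> nat \<Rightarrow> 'b \<Rightarrow> 'k" where
  "collapse x = (\<lambda>i c. aug (\<lambda>d. x i (c, d)))"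

lemma module_hom_tensor_one: "module_hom lact blact r r
    (tensor_one :: (nat \<Rightarrow> 'b::monoid_mult \<Rightarrow> 'k::comm_ring_1) \<Rightarrow> _)"
  unfolding module_hom_def
proof (intro conjI ballI allI impI)
  fix x y :: "nat \<Rightarrow> 'b::monoid_mult \<Rightarrow> 'k::comm_ring_1" and a :: "'b \<Rightarrow> 'k"
  assume x: "x \<in> free_carrier r"
  have "fsupp (tensor_one x i)" for i
    by (rule fsupp_mono[of "{c. x i c \<noteq> 0} \<times> {1}"])
       (use x in \<open>auto simp: free_carrier_iff fsupp_def tensor_one_def split: if_splits\<close>)
  then show "tensor_one x \<in> free_carrier r"
    using x by (auto simp: free_carrier_iff tensor_one_def fun_eq_iff)
  show "tensor_one (x + y) = tensor_one x + tensor_one y"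
    by (auto simp: tensor_one_def fun_eq_iff)
  show "tensor_one (lact a x) = blact a (tensor_one x)"
    by (auto simp: tensor_one_def fun_eq_iff blact_apply lact_def)
qed

text \<open>Left multiplication works on the first coordinate, the augmentation sums over the
  second, so two finite sums are interchanged. \<open>?E\<close> and \<open>?D\<close> are the
  projections of the support of \<open>f\<close>, which makes the ranges independent of each
  other.\<close>

lemma aug_mr_mult_slice:
  assumes a: "fsupp a" and f: "fsupp f"
  shows "aug (\<lambda>d. mr_mult a (\<lambda>e. f (e, d)) c) = mr_mult a (\<lambda>e. aug (\<lambda>d. f (e, d))) c"
proof -
  let ?A = "{x. a x \<noteq> 0}" and ?E = "fst ` {p. f p \<noteq> 0}" and ?D = "snd ` {p. f p \<noteq> 0}"
  have fin: "finite ?A" "finite ?E" "finite ?D" using a f by (auto simp: fsupp_def)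
  have aug: "aug (\<lambda>d. f (e, d)) = (\<Sum>d\<in>?D. f (e, d))" for e
    using fin by (intro aug_eq_sum) force+
  have nz: "\<exists>d. f (e, d) \<noteq> 0" if "aug (\<lambda>d. f (e, d)) \<noteq> 0" for e
    using that by (rule aug_nonzeroD)
  have "aug (\<lambda>d. mr_mult a (\<lambda>e. f (e, d)) c) = (\<Sum>d\<in>?D. mr_mult a (\<lambda>e. f (e, d)) c)"
    using fin by (intro aug_eq_sum) (auto elim!: mr_mult_nonzeroD, force)
  also have "\<dots> = (\<Sum>d\<in>?D. \<Sum>x\<in>?A. \<Sum>e\<in>?E. if x * e = c then a x * f (e, d) else 0)"
    using fin by (intro sum.cong refl mr_mult_eq_sum) force+
  also have "\<dots> = (\<Sum>x\<in>?A. \<Sum>e\<in>?E. \<Sum>d\<in>?D. if x * e = c then a x * f (e, d) else 0)"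
    by (rule sum_rotate)
  also have "\<dots> = (\<Sum>x\<in>?A. \<Sum>e\<in>?E. if x * e = c then a x * aug (\<lambda>d. f (e, d)) else 0)"
    unfolding aug by (intro sum.cong refl) (auto simp: sum_distrib_left)
  also have "\<dots> = mr_mult a (\<lambda>e. aug (\<lambda>d. f (e, d))) c"
    using fin by (intro mr_mult_eq_sum[symmetric]) (auto dest!: nz, force)
  finally show ?thesis .
qed

lemma module_hom_collapse: "module_hom blact lact r r
    (collapse :: (nat \<Rightarrow> 'b::monoid_mult \<times> 'b \<Rightarrow> 'k::comm_ring_1) \<Rightarrow> _)"
  unfolding module_hom_def
proof (intro conjI ballI allI impI)
  fix x y :: "nat \<Rightarrow> 'b::monoid_mult \<times> 'b \<Rightarrow> 'k::comm_ring_1"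
  assume x: "x \<in> free_carrier r"
  have "fsupp (collapse x i)" for i
  proof (rule fsupp_mono)
    show "finite (fst ` {p. x i p \<noteq> 0})"
      using x by (auto simp: free_carrier_iff fsupp_def)
    show "c \<in> fst ` {p. x i p \<noteq> 0}" if "collapse x i c \<noteq> 0" for c
    proof -
      have "\<exists>d. x i (c, d) \<noteq> 0" using that unfolding collapse_def by (rule aug_nonzeroD)
      then show ?thesis by force
    qed
  qed
  then show "collapse x \<in> free_carrier r"
    using x by (auto simp: free_carrier_iff collapse_def fun_eq_iff aug_def)
  show "collapse (x + y) = collapse x + collapse y" if y: "y \<in> free_carrier r"
  proof (intro ext)
    fix i c
    show "collapse (x + y) i c = (collapse x + collapse y) i c"
      using aug_add[of "\<lambda>d. x i (c, d)" "\<lambda>d. y i (c, d)"] x y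
      by (simp add: collapse_def free_carrier_iff fsupp_slice plus_fun_def)
  qed
  show "collapse (blact a x) = lact a (collapse x)" if "fsupp a" for a
    using that x by (auto simp: collapse_def lact_def blact_apply aug_mr_mult_slice free_carrier_iff fun_eq_iff)
qed

lemma collapse_tensor_one: "collapse (tensor_one x) = x"
proof (intro ext)
  fix i c
  show "collapse (tensor_one x) i c = x i c"
    unfolding collapse_def tensor_one_def by (subst aug_eq_sum[of "{1}"]) auto
qed

text \<open>The augmentation is multiplicative and sends \<open>single b\<close> to 1.\<close>

lemma collapse_bract:
  assumes "x \<in> free_carrier r"
  shows "collapse (bract x (single b)) = collapse x"
  using assms
  by (auto simp: collapse_def bract_apply aug_mr_mult fsupp_slice free_carrier_iff fun_eq_iff)

text \<open>The universal property of \<open>collapse\<close>. An element \<open>u\<close> is the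
  sum over \<open>b\<close> of (its slice at \<open>b\<close> \<otimes> 1) times \<open>b\<close>;
  invariance of \<open>q\<close> deletes each factor \<open>b\<close>, and the slices add up to
  \<open>collapse u\<close>.\<close>

lemma right_invariant_factor:
  fixes q :: "(nat \<Rightarrow> 'b::monoid_mult \<times> 'b \<Rightarrow> 'k::comm_ring_1) \<Rightarrow> 'm::ab_group_add"
  assumes add: "\<forall>x\<in>free_carrier r. \<forall>y\<in>free_carrier r. q (x + y) = q x + q y"
    and inv: "\<And>x b. x \<in> free_carrier r \<Longrightarrow> q (bract x (single b)) = q x"
    and u: "u \<in> free_carrier r"
  shows "q (tensor_one (collapse u)) = q u"
proof -
  define S where "S = (\<Union>i<r. snd ` {p. u i p \<noteq> 0})"
  define sl where "sl b = (\<lambda>i c. u i (c, b))" for b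
  \<comment> \<open>\<open>v b\<close> is the part of \<open>u\<close> with right coordinate
    \<open>b\<close>, written as a right multiple so that \<open>inv\<close> applies to it.\<close>
  define v where "v b = bract (tensor_one (sl b)) (single b)" for b
  have S: "finite S" using u by (auto simp: S_def free_carrier_iff fsupp_def)
  have in_S: "d \<in> S" if "u i (c, d) \<noteq> 0" for i c d
  proof -
    have "i < r" using that u by (metis free_carrier_iff linorder_not_less zero_fun_apply)
    then show ?thesis using that unfolding S_def by force
  qed
  have sl: "sl b \<in> free_carrier r" for b
    using u by (auto simp: free_carrier_iff sl_def fsupp_slice fun_eq_iff)
  have v_apply: "v b i (c, d) = (if d = b then u i (c, d) else 0)" for b i c d
    by (auto simp: v_def bract_apply tensor_one_def mr_mult_single_single sl_def)
  have "fsupp (v b i)" for b i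
    by (rule fsupp_mono[of "{p. u i p \<noteq> 0}"])
       (use u in \<open>auto simp: free_carrier_iff fsupp_def v_apply split: if_splits\<close>)
  then have v: "v b \<in> free_carrier r" for b
    using u by (auto simp: free_carrier_iff v_apply fun_eq_iff)
  have "u = (\<Sum>b\<in>S. v b)"
    using S in_S by (auto simp: fun_eq_iff fun_sum_apply v_apply)
  then have "q u = (\<Sum>b\<in>S. q (v b))"
    using additive_sum[OF add, of S v] v by simp
  also have "\<dots> = (\<Sum>b\<in>S. q (tensor_one (sl b)))"
    unfolding v_def by (intro sum.cong refl inv) (rule module_homD(1)[OF module_hom_tensor_one sl])
  also have "\<dots> = q (\<Sum>b\<in>S. tensor_one (sl b))"
    by (rule additive_sum[OF add, symmetric]) (rule module_homD(1)[OF module_hom_tensor_one sl])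
  also have "(\<Sum>b\<in>S. tensor_one (sl b)) = tensor_one (\<Sum>b\<in>S. sl b)"
    by (rule module_hom_sum[OF module_hom_tensor_one sl, symmetric])
  also have "(\<Sum>b\<in>S. sl b) = collapse u"
  proof (intro ext)
    fix i c
    have "collapse u i c = (\<Sum>d\<in>S. u i (c, d))"
      unfolding collapse_def using S in_S by (intro aug_eq_sum) auto
    then show "(\<Sum>b\<in>S. sl b) i c = collapse u i c" by (simp add: fun_sum_apply sl_def)
  qed
  finally show ?thesis by simp
qed

section \<open>Direct sums of free modules in coordinates\<close>

definition take_coords :: "nat \<Rightarrow> (nat \<Rightarrow> 'x \<Rightarrow> 'k::zero) \<Rightarrow> nat \<Rightarrow> 'x \<Rightarrow> 'k" where
  "take_coords r x = (\<lambda>i. if i < r then x i else 0)"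

definition drop_coords :: "nat \<Rightarrow> (nat \<Rightarrow> 'x \<Rightarrow> 'k::zero) \<Rightarrow> nat \<Rightarrow> 'x \<Rightarrow> 'k" where
  "drop_coords r x = (\<lambda>i. x (i + r))"

text \<open>The first summand occupies the first \<open>r\<close> coordinates, so its inclusion is
  the identity map and only the second inclusion is a shift.\<close>

definition shift_coords :: "nat \<Rightarrow> (nat \<Rightarrow> 'x \<Rightarrow> 'k::zero) \<Rightarrow> nat \<Rightarrow> 'x \<Rightarrow> 'k" where
  "shift_coords r x = (\<lambda>i. if i < r then 0 else x (i - r))"

lemma module_hom_take_coords: "module_hom lact lact s r (take_coords r)"
  by (auto simp: module_hom_def take_coords_def free_carrier_iff lact_def fun_eq_iff)

lemma module_hom_drop_coords: "module_hom lact lact (r + s) s (drop_coords r)"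
  by (auto simp: module_hom_def drop_coords_def free_carrier_iff lact_def fun_eq_iff)

lemma module_hom_shift_coords: "module_hom lact lact s (r + s) (shift_coords r)"
  by (auto simp: module_hom_def shift_coords_def free_carrier_iff lact_def fun_eq_iff)

lemma take_coords_id: "x \<in> free_carrier r \<Longrightarrow> take_coords r x = x"
  by (auto simp: take_coords_def free_carrier_iff fun_eq_iff)

lemma drop_coords_zero: "x \<in> free_carrier r \<Longrightarrow> drop_coords r x = 0"
  by (auto simp: drop_coords_def free_carrier_iff fun_eq_iff)

lemma take_shift_coords: "take_coords r (shift_coords r x) = 0"
  by (auto simp: take_coords_def shift_coords_def fun_eq_iff)

lemma drop_shift_coords: "drop_coords r (shift_coords r x) = x"
  by (auto simp: drop_coords_def shift_coords_def fun_eq_iff)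

section \<open>Building the one-sided resolution\<close>

text \<open>The state in one degree: \<open>r\<close>, \<open>s\<close> are the ranks of \<open>F\<^sub>m\<close>, \<open>G\<^sub>m\<close>, and \<open>ZF\<close>, \<open>ZG\<close> their
  cycles; \<open>\<phi>\<close> is \<open>id - collapse \<circ> f - h \<circ> d\<close> for a homotopy \<open>h\<close> from \<open>id\<close> to \<open>collapse \<circ> f\<close> in lower degrees.\<close>

definition comparison ::
  "nat \<Rightarrow> nat \<Rightarrow> (nat \<Rightarrow> 'b::monoid_mult \<times> 'b \<Rightarrow> 'k::comm_ring_1) set \<Rightarrow> (nat \<Rightarrow> 'b \<Rightarrow> 'k) set
    \<Rightarrow> ((nat \<Rightarrow> 'b \<Rightarrow> 'k) \<Rightarrow> nat \<Rightarrow> 'b \<times> 'b \<Rightarrow> 'k) \<Rightarrow> ((nat \<Rightarrow> 'b \<Rightarrow> 'k) \<Rightarrow> nat \<Rightarrow> 'b \<Rightarrow> 'k) \<Rightarrow> bool"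
  where
  "comparison r s ZF ZG f \<phi> \<longleftrightarrow> r \<le> s \<and> module_hom lact blact s r f \<and> module_hom lact lact s s \<phi> \<and>
     f ` ZG \<subseteq> ZF \<and> collapse ` ZF \<subseteq> ZG \<and> \<phi> ` free_carrier s \<subseteq> ZG \<and>
     (\<forall>z\<in>ZG. \<phi> z = z - collapse (f z))"

text \<open>The induction step of the construction: from comparison data for the cycles in one
  degree it produces a differential onto \<open>ZG\<close> and comparison data for the cycles one
  degree higher.\<close>

lemma comparison_step:
  fixes dF :: "(nat \<Rightarrow> 'b::monoid_mult \<times> 'b \<Rightarrow> 'k::comm_ring_1) \<Rightarrow> nat \<Rightarrow> 'b \<times> 'b \<Rightarrow> 'k"
  assumes cmp: "comparison r s ZF ZG f \<phi>"
    and dF: "module_hom blact blact r' r dF"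
    and dF_right: "\<And>x b. x \<in> free_carrier r' \<Longrightarrow> dF (bract x (single b)) = bract (dF x) (single b)"
    and ZF: "ZF = dF ` free_carrier r'"
    and ZG: "ZG \<subseteq> free_carrier s" "\<And>x y. x \<in> ZG \<Longrightarrow> y \<in> ZG \<Longrightarrow> x + y \<in> ZG"
  obtains d' f' \<phi>' where "module_hom lact lact (r' + s) s d'" "ZG = d' ` free_carrier (r' + s)"
    "comparison r' (r' + s) {u \<in> free_carrier r'. dF u = 0} {y \<in> free_carrier (r' + s). d' y = 0} f' \<phi>'"
proof -
  have rs: "r \<le> s" and f: "module_hom lact blact s r f" and \<phi>: "module_hom lact lact s s \<phi>"
    and fZ: "\<And>z. z \<in> ZG \<Longrightarrow> f z \<in> ZF" and cZ: "\<And>u. u \<in> ZF \<Longrightarrow> collapse u \<in> ZG"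
    and \<phi>_im: "\<And>x. x \<in> free_carrier s \<Longrightarrow> \<phi> x \<in> ZG"
    and \<phi>_Z: "\<And>z. z \<in> ZG \<Longrightarrow> \<phi> z = z - collapse (f z)"
    using cmp by (auto simp: comparison_def)
  \<comment> \<open>\<open>dF\<close> commutes with right multiplication and \<open>collapse\<close>
    forgets it, so \<open>q\<close> is right invariant and descends to the collapsed module.\<close>
  define q where "q u = collapse (dF u)" for u
  have q: "module_hom blact lact r' s q"
    unfolding q_def by (rule module_hom_mono[OF module_hom_comp[OF dF module_hom_collapse] rs])
  have q_factor: "q (tensor_one (collapse u)) = q u" if "u \<in> free_carrier r'" for u
    using that
    by (intro right_invariant_factor[OF module_hom_additive[OF q]])
       (auto simp: q_def dF_right collapse_bract[OF module_homD(1)[OF dF]])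
  have q_im: "q u \<in> ZG" if "u \<in> free_carrier r'" for u
    using that cZ by (auto simp: q_def ZF)
  \<comment> \<open>The induced map on the first summand is evaluated through the section
    \<open>tensor_one\<close>; by \<open>q_factor\<close> the choice of section is harmless.\<close>
  define d' where "d' y = q (tensor_one (take_coords r' y)) + \<phi> (drop_coords r' y)" for y
  have d': "module_hom lact lact (r' + s) s d'"
    unfolding d'_def
    by (intro module_hom_plus lact.monoid_ring_action_axioms
        module_hom_comp[OF module_hom_comp[OF module_hom_take_coords module_hom_tensor_one] q]
        module_hom_comp[OF module_hom_drop_coords \<phi>])
  have d'_im: "d' y \<in> ZG" if "y \<in> free_carrier (r' + s)" for y
    unfolding d'_def using that
    by (intro ZG(2) q_im \<phi>_im module_homD(1)[OF module_hom_tensor_one]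
        module_homD(1)[OF module_hom_take_coords] module_homD(1)[OF module_hom_drop_coords])
  have collapse_in: "collapse u \<in> free_carrier r'" if "u \<in> free_carrier r'" for u
    using module_homD(1)[OF module_hom_collapse that] .
  have d'_collapse: "d' (collapse u) = q u" if "u \<in> free_carrier r'" for u
    using collapse_in[OF that]
    by (simp add: d'_def take_coords_id drop_coords_zero q_factor that module_hom_zero[OF \<phi>])
  have d'_shift: "d' (shift_coords r' x) = \<phi> x" for x
    by (simp add: d'_def take_shift_coords drop_shift_coords module_hom_zero[OF q]
        module_hom_zero[OF module_hom_tensor_one])
  have incl: "x \<in> free_carrier (r' + s)" if "x \<in> free_carrier r'" for x :: "nat \<Rightarrow> 'b \<Rightarrow> 'k"
    using that free_carrier_mono[of r' "r' + s"] by auto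
  have shift_in: "shift_coords r' x \<in> free_carrier (r' + s)" if "x \<in> free_carrier s"
    for x :: "nat \<Rightarrow> 'b \<Rightarrow> 'k"
    using module_homD(1)[OF module_hom_shift_coords that] .
  have exact: "ZG = d' ` free_carrier (r' + s)"
  proof (intro equalityI subsetI)
    fix z assume z: "z \<in> ZG"
    then obtain u where u: "u \<in> free_carrier r'" "f z = dF u"
      using fZ ZF by blast
    have zs: "z \<in> free_carrier s" using z ZG by auto
    \<comment> \<open>As \<open>dF u = f z\<close>, the two summands contribute
      \<open>collapse (f z)\<close> and \<open>z - collapse (f z)\<close>.\<close>
    have "d' (collapse u + shift_coords r' z) = q u + \<phi> z"
      using u zs by (simp add: module_homD(2)[OF d'] incl collapse_in shift_in d'_collapse d'_shift)
    also have "\<dots> = z" using z u by (simp add: \<phi>_Z q_def)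
    finally show "z \<in> d' ` free_carrier (r' + s)"
      using free_carrier_add[OF incl[OF collapse_in[OF u(1)]] shift_in[OF zs]]
      by (intro image_eqI[of z _ "collapse u + shift_coords r' z"]) simp_all
  qed (use d'_im in auto)
  \<comment> \<open>\<open>d'\<close> lands in \<open>ZG\<close>, which \<open>f\<close> maps into
    \<open>ZF\<close>, the image of \<open>dF\<close>; hence \<open>f \<circ> d'\<close> lifts
    through \<open>dF\<close>.\<close>
  obtain f' where f': "module_hom lact blact (r' + s) r' f'"
    and dF_f': "\<And>y. y \<in> free_carrier (r' + s) \<Longrightarrow> dF (f' y) = f (d' y)"
  proof (rule module_hom_lift[OF blact.monoid_ring_action_axioms module_hom_comp[OF d' f] dF])
    show "f (d' x) \<in> dF ` free_carrier r'" if "x \<in> free_carrier (r' + s)" for x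
      using fZ[OF d'_im[OF that]] by (simp add: ZF)
  qed blast
  \<comment> \<open>The inclusion of the old module as second summand is the homotopy. Its term
    makes \<open>d' (\<phi>' y)\<close> cancel, because \<phi> is known on \<open>d' y\<close>, an
    element of \<open>ZG\<close>; on cycles of \<open>d'\<close> the term vanishes.\<close>
  define \<phi>' where "\<phi>' y = y - collapse (f' y) - shift_coords r' (d' y)" for y
  have \<phi>': "module_hom lact lact (r' + s) (r' + s) \<phi>'"
    unfolding \<phi>'_def
    by (intro module_hom_minus lact.monoid_ring_action_axioms module_hom_id order_refl
        module_hom_mono[OF module_hom_comp[OF f' module_hom_collapse]]
        module_hom_comp[OF d' module_hom_shift_coords]) simp
  have d'_\<phi>': "d' (\<phi>' y) = 0" if y: "y \<in> free_carrier (r' + s)" for y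
  proof -
    have 1: "f' y \<in> free_carrier r'" "d' y \<in> free_carrier s"
      using module_homD(1)[OF f' y] module_homD(1)[OF d' y] .
    have "d' (\<phi>' y) = d' y - d' (collapse (f' y)) - d' (shift_coords r' (d' y))"
      unfolding \<phi>'_def using y 1
      by (simp add: module_hom_diff[OF d'] free_carrier_diff incl collapse_in shift_in)
    also have "\<dots> = d' y - collapse (f (d' y)) - \<phi> (d' y)"
      using 1 y by (simp add: d'_collapse d'_shift q_def dF_f')
    also have "\<dots> = 0" using d'_im[OF y] by (simp add: \<phi>_Z)
    finally show ?thesis .
  qed
  have "comparison r' (r' + s) {u \<in> free_carrier r'. dF u = 0}
      {y \<in> free_carrier (r' + s). d' y = 0} f' \<phi>'"
    unfolding comparison_def
  proof (intro conjI)
    show "f' ` {y \<in> free_carrier (r' + s). d' y = 0} \<subseteq> {u \<in> free_carrier r'. dF u = 0}"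
      using module_homD(1)[OF f'] dF_f' module_hom_zero[OF f] by auto
    show "collapse ` {u \<in> free_carrier r'. dF u = 0} \<subseteq> {y \<in> free_carrier (r' + s). d' y = 0}"
      using collapse_in incl d'_collapse module_hom_zero[OF module_hom_collapse] by (auto simp: q_def)
    show "\<phi>' ` free_carrier (r' + s) \<subseteq> {y \<in> free_carrier (r' + s). d' y = 0}"
      using module_homD(1)[OF \<phi>'] d'_\<phi>' by auto
    show "\<forall>z\<in>{y \<in> free_carrier (r' + s). d' y = 0}. \<phi>' z = z - collapse (f' z)"
      by (simp add: \<phi>'_def module_hom_zero[OF module_hom_shift_coords])
  qed (use f' \<phi>' in auto)
  with d' exact show ?thesis using that by blast
qed

section \<open>Resolutions restated through cycles and homomorphisms\<close>

definition cycles ::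
  "(nat \<Rightarrow> nat) \<Rightarrow> (nat \<Rightarrow> (nat \<Rightarrow> 'x \<Rightarrow> 'k::zero) \<Rightarrow> nat \<Rightarrow> 'x \<Rightarrow> 'k) \<Rightarrow> ((nat \<Rightarrow> 'x \<Rightarrow> 'k) \<Rightarrow> 'k)
    \<Rightarrow> nat \<Rightarrow> (nat \<Rightarrow> 'x \<Rightarrow> 'k) set" where
  "cycles r d eps i = {x \<in> free_carrier (r i). if i = 0 then eps x = 0 else d i x = 0}"

text \<open>With \<open>eps\<close> as the outgoing map in degree 0, both exactness clauses become
  one statement about \<open>cycles\<close>. Shifting the index by one then places all conditions on
  \<open>d (Suc i)\<close> under a single quantifier.\<close>

lemma FPn_resolution_iff:
  "FPn_resolution Ops n r d eps \<longleftrightarrow>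
     (\<forall>x\<in>free_carrier (r 0). \<forall>y\<in>free_carrier (r 0). eps (x + y) = eps x + eps y) \<and>
     (\<forall>(T, s)\<in>Ops. \<forall>x\<in>free_carrier (r 0). eps (T x) = s (eps x)) \<and>
     eps ` free_carrier (r 0) = UNIV \<and>
     (\<forall>i<n.
        (\<forall>x\<in>free_carrier (r (Suc i)). d (Suc i) x \<in> free_carrier (r i)) \<and>
        (\<forall>x\<in>free_carrier (r (Suc i)). \<forall>y\<in>free_carrier (r (Suc i)).
            d (Suc i) (x + y) = d (Suc i) x + d (Suc i) y) \<and>
        (\<forall>(T, s)\<in>Ops. \<forall>x\<in>free_carrier (r (Suc i)). d (Suc i) (T x) = T (d (Suc i) x)) \<and>
        cycles r d eps i = d (Suc i) ` free_carrier (r (Suc i)))"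
proof -
  have shift: "(\<forall>i. 1 \<le> i \<and> i \<le> n \<longrightarrow> P i) \<longleftrightarrow> (\<forall>i<n. P (Suc i))" for P
  proof (intro iffI allI impI)
    fix i assume "\<forall>i<n. P (Suc i)" "1 \<le> i \<and> i \<le> n"
    then show "P i" by (cases i) auto
  qed auto
  have conj: "(\<forall>i<n. A i \<and> B i \<and> C i) \<and> (\<forall>i<n. E i) \<longleftrightarrow> (\<forall>i<n. A i \<and> B i \<and> C i \<and> E i)" for A B C E
    by blast
  have zero: "(\<lambda>_ _. 0) = (0 :: nat \<Rightarrow> 'a \<Rightarrow> 'b)" by (simp add: fun_eq_iff)
  have exact: "((1 \<le> n \<longrightarrow> {x\<in>free_carrier (r 0). eps x = 0} = d 1 ` free_carrier (r 1)) \<and>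
     (\<forall>i. 1 \<le> i \<and> i < n \<longrightarrow> {x\<in>free_carrier (r i). d i x = 0} = d (Suc i) ` free_carrier (r (Suc i))))
     \<longleftrightarrow> (\<forall>i<n. cycles r d eps i = d (Suc i) ` free_carrier (r (Suc i)))" (is "?L \<longleftrightarrow> ?R")
  proof
    assume L: ?L
    show ?R
    proof (intro allI impI)
      fix i assume "i < n"
      with L show "cycles r d eps i = d (Suc i) ` free_carrier (r (Suc i))"
        by (cases i) (auto simp: cycles_def)
    qed
  next
    assume R: ?R
    show ?L
    proof (intro conjI allI impI)
      show "{x\<in>free_carrier (r 0). eps x = 0} = d 1 ` free_carrier (r 1)" if "1 \<le> n"
        using R[rule_format, of 0] that by (simp add: cycles_def)
      show "{x\<in>free_carrier (r i). d i x = 0} = d (Suc i) ` free_carrier (r (Suc i))"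
        if "1 \<le> i \<and> i < n" for i
        using R[rule_format, of i] that by (simp add: cycles_def)
    qed
  qed
  show ?thesis
    unfolding FPn_resolution_def fadd_eq shift zero exact diff_Suc_1 conj by (rule refl)
qed

lemma left_resolution_iff:
  "FPn_resolution left_ops n r d eps \<longleftrightarrow>
     (\<forall>x\<in>free_carrier (r 0). \<forall>y\<in>free_carrier (r 0). eps (x + y) = eps x + eps y) \<and>
     (\<forall>a. fsupp a \<longrightarrow> (\<forall>x\<in>free_carrier (r 0). eps (lact a x) = aug a * eps x)) \<and>
     eps ` free_carrier (r 0) = UNIV \<and>
     (\<forall>i<n. module_hom lact lact (r (Suc i)) (r i) (d (Suc i)) \<and>
        cycles r d eps i = d (Suc i) ` free_carrier (r (Suc i)))"
proof -
  have ops: "(\<forall>(T, s)\<in>left_ops. P T s) \<longleftrightarrow> (\<forall>a. fsupp a \<longrightarrow> P (lact a) (\<lambda>k. aug a * k))"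
    for P
    by (auto simp: left_ops_def monoid_ring_def)
  show ?thesis
    unfolding FPn_resolution_iff ops module_hom_def by (simp only: conj_assoc)
qed

text \<open>Since \<open>bi_ops\<close> is a union, linearity splits into a left half, which is
  \<open>module_hom\<close> for the differentials, and commutation with the right action.\<close>

lemma bi_resolution_iff:
  "FPn_resolution bi_ops n r d eps \<longleftrightarrow>
     (\<forall>x\<in>free_carrier (r 0). \<forall>y\<in>free_carrier (r 0). eps (x + y) = eps x + eps y) \<and>
     (\<forall>a. fsupp a \<longrightarrow> (\<forall>x\<in>free_carrier (r 0). eps (blact a x) = aug a * eps x)) \<and>
     (\<forall>a. fsupp a \<longrightarrow> (\<forall>x\<in>free_carrier (r 0). eps (bract x a) = eps x * aug a)) \<and>
     eps ` free_carrier (r 0) = UNIV \<and>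
     (\<forall>i<n. module_hom blact blact (r (Suc i)) (r i) (d (Suc i)) \<and>
        (\<forall>a. fsupp a \<longrightarrow> (\<forall>x\<in>free_carrier (r (Suc i)). d (Suc i) (bract x a) = bract (d (Suc i) x) a)) \<and>
        cycles r d eps i = d (Suc i) ` free_carrier (r (Suc i)))"
proof -
  have ops: "(\<forall>(T, s)\<in>bi_ops. P T s) \<longleftrightarrow> (\<forall>a. fsupp a \<longrightarrow> P (blact a) (\<lambda>k. aug a * k)) \<and>
      (\<forall>a. fsupp a \<longrightarrow> P (\<lambda>x. bract x a) (\<lambda>k. k * aug a))"
    for P
    by (auto simp: bi_ops_def monoid_ring_def)
  show ?thesis
    unfolding FPn_resolution_iff ops module_hom_def by (simp only: conj_assoc)
qed

text \<open>Induction on the length \<open>m\<close>, with the bimodule resolution fixed and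
  comparison data carried along for the cycles in the top degree. The augmentation is the same at
  every stage.\<close>

lemma left_resolution_of_bi_resolution:
  fixes eps :: "(nat \<Rightarrow> 'b::monoid_mult \<times> 'b \<Rightarrow> 'k::comm_ring_1) \<Rightarrow> 'k"
  assumes F: "FPn_resolution bi_ops n r d eps" and "m \<le> n"
  shows "\<exists>s D f \<phi>. FPn_resolution left_ops m s D (\<lambda>x. eps (tensor_one x)) \<and>
    comparison (r m) (s m) (cycles r d eps m) (cycles s D (\<lambda>x. eps (tensor_one x)) m) f \<phi>"
  using \<open>m \<le> n\<close>
proof (induction m)
  case 0
  let ?e = "\<lambda>x. eps (tensor_one x)"
  note F' = F[unfolded bi_resolution_iff]
  \<comment> \<open>\<open>eps\<close> is invariant under right multiplication by
    \<open>single b\<close>, whose augmentation is 1, so it factors through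
    \<open>collapse\<close>.\<close>
  have inv: "?e (collapse u) = eps u" if "u \<in> free_carrier (r 0)" for u
    using right_invariant_factor[OF conjunct1[OF F'] _ that] F' by simp
  have c_in: "collapse u \<in> free_carrier (r 0)" if "u \<in> free_carrier (r 0)" for u
    using module_homD(1)[OF module_hom_collapse that] .
  note t = module_homD[OF module_hom_tensor_one[of "r 0"]]
  have e0: "?e 0 = 0"
    using module_hom_zero[OF module_hom_tensor_one[of "r 0"]] additive_zero[OF conjunct1[OF F']]
    by metis
  have surj: "?e ` free_carrier (r 0) = UNIV"
  proof -
    have "k \<in> ?e ` free_carrier (r 0)" for k
    proof -
      obtain u where "u \<in> free_carrier (r 0)" "eps u = k"
        using F' by (metis UNIV_I image_iff)
      then show ?thesis using inv c_in by (metis image_eqI)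
    qed
    then show ?thesis by auto
  qed
  have "FPn_resolution left_ops 0 r D ?e" for D
    unfolding left_resolution_iff
    using F' surj by (simp add: t)
  \<comment> \<open>In degree 0 the map \<open>f\<close> is a section of \<open>collapse\<close>, so
    the defect \<open>z - collapse (f z)\<close> is zero. \<open>D\<close> stays arbitrary because
    no differential starts in degree 0.\<close>
  moreover have "comparison (r 0) (r 0) (cycles r d eps 0) (cycles r D ?e 0) tensor_one (\<lambda>_. 0)" for D
    using inv c_in t(1) module_hom_tensor_one[of "r 0"] e0
    by (auto simp: comparison_def cycles_def collapse_tensor_one module_hom_def lact.zero_right)
  ultimately show ?case by blast
next
  case (Suc m)
  let ?e = "\<lambda>x. eps (tensor_one x)"
  obtain s D f \<phi> where G: "FPn_resolution left_ops m s D ?e"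
    and cmp: "comparison (r m) (s m) (cycles r d eps m) (cycles s D ?e m) f \<phi>"
    using Suc by auto
  have m: "m < n" using Suc by simp
  note F' = F[unfolded bi_resolution_iff] and G' = G[unfolded left_resolution_iff]
  have Z: "cycles s D ?e m \<subseteq> free_carrier (s m)" by (auto simp: cycles_def)
  \<comment> \<open>Cycles are the kernel of the augmentation in degree 0 and of \<open>D m\<close>
    above, hence the case split.\<close>
  have Z_add: "x + y \<in> cycles s D ?e m" if xy: "x \<in> cycles s D ?e m" "y \<in> cycles s D ?e m" for x y
  proof (cases m)
    case 0
    then show ?thesis using xy G' by (auto simp: cycles_def intro: free_carrier_add)
  next
    case (Suc j)
    then have "module_hom lact lact (s m) (s j) (D m)" using G' by auto
    then show ?thesis
      using xy Suc by (auto simp: cycles_def free_carrier_add module_homD(2) fun_eq_iff)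
  qed
  obtain d' f' \<phi>' where new: "module_hom lact lact (r (Suc m) + s m) (s m) d'"
      "cycles s D ?e m = d' ` free_carrier (r (Suc m) + s m)"
      "comparison (r (Suc m)) (r (Suc m) + s m) {u \<in> free_carrier (r (Suc m)). d (Suc m) u = 0}
         {y \<in> free_carrier (r (Suc m) + s m). d' y = 0} f' \<phi>'"
    by (rule comparison_step[OF cmp _ _ _ Z Z_add, of "r (Suc m)" "d (Suc m)"])
       (use F' m in \<open>auto simp del: image_eqI\<close>)
  \<comment> \<open>Only the entries at \<open>Suc m\<close> change, so all cycles up to degree
    \<open>m\<close> are preserved.\<close>
  define s' D' where "s' = s(Suc m := r (Suc m) + s m)" and "D' = D(Suc m := d')"
  have cyc: "cycles s' D' ?e i = cycles s D ?e i" if "i \<le> m" for i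
    using that by (auto simp: cycles_def s'_def D'_def)
  have "FPn_resolution left_ops (Suc m) s' D' ?e"
    unfolding left_resolution_iff
  proof (intro conjI allI impI)
    fix i assume "i < Suc m"
    then consider "i < m" | "i = m" by linarith
    then show "module_hom lact lact (s' (Suc i)) (s' i) (D' (Suc i))"
      "cycles s' D' ?e i = D' (Suc i) ` free_carrier (s' (Suc i))"
      by (cases; use G' new cyc[of i] in \<open>simp add: s'_def D'_def\<close>)+
  qed (use G' in \<open>auto simp: s'_def\<close>)
  moreover have "comparison (r (Suc m)) (s' (Suc m)) (cycles r d eps (Suc m))
      (cycles s' D' ?e (Suc m)) f' \<phi>'"
    using new(3) by (simp add: cycles_def s'_def D'_def)
  ultimately show ?case by blast
qed

theorem weak_bi_FP_imp_left_FP: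
  assumes "weak_bi_FP TYPE('k::comm_ring_1) TYPE('b::monoid_mult) n"
  shows "left_FP TYPE('k) TYPE('b) n"
  using assms left_resolution_of_bi_resolution[where m = n and n = n]
  unfolding weak_bi_FP_def left_FP_def by blast

section \<open>The opposite monoid\<close>

text \<open>The monoid structure is attached to the type by its class, so the reversed
  multiplication requires a type of its own.\<close>

datatype 'b opp = Opp (unopp: 'b)

instantiation opp :: (monoid_mult) monoid_mult
begin

definition "1 = Opp 1"

definition "a * b = Opp (unopp b * unopp a)"

instance
  by standard (auto simp: one_opp_def times_opp_def mult.assoc)

end

text \<open>Relabelling by \<open>Opp\<close> is an anti-isomorphism of monoid rings; the
  coefficients may be swapped because \<open>K\<close> is commutative.\<close>

lemma mr_mult_opp: "mr_mult f g c = mr_mult (\<lambda>b. g (Opp b)) (\<lambda>b. f (Opp b)) (unopp c)"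
  unfolding mr_mult_def
  by (rule sum.reindex_bij_witness[of _ "\<lambda>(a, b). (Opp b, Opp a)" "\<lambda>(a, b). (unopp b, unopp a)"])
     (auto simp: times_opp_def mult.commute)

lemma aug_opp: "aug (\<lambda>b. f (Opp b)) = aug f"
  unfolding aug_def by (rule sum.reindex_bij_witness[of _ unopp Opp]) auto

lemma fsupp_inj: "fsupp f \<Longrightarrow> inj h \<Longrightarrow> fsupp (\<lambda>x. f (h x))"
  using finite_vimageI[of "{x. f x \<noteq> 0}" h] by (simp add: fsupp_def vimage_def)

section \<open>Transport of resolutions along a bijection of bases\<close>

definition reindex :: "('y \<Rightarrow> 'x) \<Rightarrow> (nat \<Rightarrow> 'x \<Rightarrow> 'k) \<Rightarrow> nat \<Rightarrow> 'y \<Rightarrow> 'k" where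
  "reindex h x = (\<lambda>i c. x i (h c))"

lemma reindex_free_carrier: "inj h \<Longrightarrow> x \<in> free_carrier r \<Longrightarrow> reindex h x \<in> free_carrier r"
  by (auto simp: free_carrier_def reindex_def fsupp_inj)

lemma reindex_add: "reindex h (x + y) = reindex h x + reindex h y"
  by (simp add: reindex_def fun_eq_iff)

text \<open>All maps are conjugated by the relabelling. It is enough that every operator in
  \<open>Ops'\<close> corresponds to one in \<open>Ops\<close> with the same effect \<open>s\<close>
  on \<open>K\<close>.\<close>

lemma FPn_resolution_reindex:
  fixes h :: "'y \<Rightarrow> 'x" and h' :: "'x \<Rightarrow> 'y"
  assumes res: "FPn_resolution Ops n r d eps"
    and h: "\<And>y. h' (h y) = y" "\<And>x. h (h' x) = x"
    and ops: "\<And>T' s. (T', s) \<in> Ops' \<Longrightarrow> \<exists>T. (T, s) \<in> Ops \<and> (\<forall>x. T' (reindex h x) = reindex h (T x))"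
  shows "FPn_resolution Ops' n r (\<lambda>i y. reindex h (d i (reindex h' y))) (\<lambda>y. eps (reindex h' y))"
proof -
  note R = res[unfolded FPn_resolution_iff]
  have inj: "inj h" "inj h'" using h by (auto intro: inj_on_inverseI)
  have inv: "reindex h (reindex h' y) = y" "reindex h' (reindex h x) = x"
    for x :: "nat \<Rightarrow> 'x \<Rightarrow> 'k" and y :: "nat \<Rightarrow> 'y \<Rightarrow> 'k"
    by (simp_all add: reindex_def h)
  note fc = reindex_free_carrier[OF inj(1)] reindex_free_carrier[OF inj(2)]
  \<comment> \<open>Relabelling maps free carriers of equal rank bijectively onto each other, so
    precomposing with it leaves images unchanged.\<close>
  have img: "g ` free_carrier k = (\<lambda>y. g (reindex h' y)) ` free_carrier k" for g k
  proof (intro equalityI subsetI)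
    fix z assume "z \<in> g ` free_carrier k"
    then obtain x where "x \<in> free_carrier k" "z = g x" by blast
    then show "z \<in> (\<lambda>y. g (reindex h' y)) ` free_carrier k"
      using fc(1)[of x k] inv(2)[of x] by (intro image_eqI[of _ _ "reindex h x"]) simp_all
  qed (use fc(2) in auto)
  have ops': "\<exists>T. (T, s) \<in> Ops \<and> (\<forall>y. T' y = reindex h (T (reindex h' y)))" if p: "(T', s) \<in> Ops'" for T' s
  proof -
    obtain T where T: "(T, s) \<in> Ops" "\<And>x. T' (reindex h x) = reindex h (T x)"
      using ops[OF p] by blast
    have "T' y = reindex h (T (reindex h' y))" for y
      using T(2)[of "reindex h' y"] unfolding inv .
    with T(1) show ?thesis by blast
  qed
  have eq0: "reindex h x = 0 \<longleftrightarrow> x = 0" for x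
  proof
    assume "reindex h x = 0"
    then have "x i (h (h' c)) = 0" for i c
      by (metis reindex_def zero_fun_apply)
    then show "x = 0" by (simp add: h fun_eq_iff)
  qed (simp add: reindex_def fun_eq_iff)
  let ?d = "\<lambda>i y. reindex h (d i (reindex h' y))" and ?e = "\<lambda>y. eps (reindex h' y)"
  show ?thesis
    unfolding FPn_resolution_iff
  proof (intro conjI allI impI ballI)
    show "?e (x + y) = ?e x + ?e y" if "x \<in> free_carrier (r 0)" "y \<in> free_carrier (r 0)" for x y
      using conjunct1[OF R, rule_format, OF fc(2)[OF that(1)] fc(2)[OF that(2)]]
      unfolding reindex_add .
    show "case p of (T, s) \<Rightarrow> \<forall>x\<in>free_carrier (r 0). ?e (T x) = s (?e x)" if p: "p \<in> Ops'" for p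
    proof (cases p)
      case (Pair T' s)
      with ops' p obtain T where T: "(T, s) \<in> Ops" "\<forall>y. T' y = reindex h (T (reindex h' y))" by blast
      have "\<forall>x\<in>free_carrier (r 0). eps (T x) = s (eps x)"
        using bspec[OF conjunct1[OF conjunct2[OF R]] T(1)] by simp
      then show ?thesis using Pair T(2) by (simp add: inv fc)
    qed
    show "?e ` free_carrier (r 0) = UNIV"
      using R img[of eps "r 0"] by simp
  next
    fix i assume i: "i < n"
    then have Ri: "\<forall>x\<in>free_carrier (r (Suc i)). d (Suc i) x \<in> free_carrier (r i)"
      "\<forall>x\<in>free_carrier (r (Suc i)). \<forall>y\<in>free_carrier (r (Suc i)).
            d (Suc i) (x + y) = d (Suc i) x + d (Suc i) y"
      "\<forall>(T, s)\<in>Ops. \<forall>x\<in>free_carrier (r (Suc i)). d (Suc i) (T x) = T (d (Suc i) x)"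
      "cycles r d eps i = d (Suc i) ` free_carrier (r (Suc i))"
      using R by blast+
    show "?d (Suc i) x \<in> free_carrier (r i)" if "x \<in> free_carrier (r (Suc i))" for x
      using that Ri(1) fc by blast
    show "?d (Suc i) (x + y) = ?d (Suc i) x + ?d (Suc i) y"
      if "x \<in> free_carrier (r (Suc i))" "y \<in> free_carrier (r (Suc i))" for x y
      using that Ri(2) by (simp add: reindex_add fc)
    show "case p of (T, s) \<Rightarrow> \<forall>x\<in>free_carrier (r (Suc i)). ?d (Suc i) (T x) = T (?d (Suc i) x)"
      if p: "p \<in> Ops'" for p
    proof (cases p)
      case (Pair T' s)
      with ops' p obtain T where T: "(T, s) \<in> Ops" "\<forall>y. T' y = reindex h (T (reindex h' y))" by blast
      have "\<forall>x\<in>free_carrier (r (Suc i)). d (Suc i) (T x) = T (d (Suc i) x)"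
        using bspec[OF Ri(3) T(1)] by simp
      then show ?thesis using Pair T(2) by (simp add: inv fc)
    qed
    have "cycles r ?d ?e i = reindex h ` cycles r d eps i"
    proof (intro equalityI subsetI)
      fix y assume "y \<in> cycles r ?d ?e i"
      then have "reindex h' y \<in> cycles r d eps i"
        using fc(2) by (auto simp: cycles_def eq0 split: if_splits)
      then show "y \<in> reindex h ` cycles r d eps i" using inv(1)[of y] by (intro image_eqI[of _ _ "reindex h' y"]) simp_all
    next
      fix y assume "y \<in> reindex h ` cycles r d eps i"
      then show "y \<in> cycles r ?d ?e i"
        using fc(1) by (auto simp: cycles_def eq0 inv split: if_splits)
    qed
    then show "cycles r ?d ?e i = ?d (Suc i) ` free_carrier (r (Suc i))"
      unfolding Ri(4) img[of "d (Suc i)"] by (simp add: image_image)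
  qed
qed

text \<open>The bimodule condition is self-dual: swapping the two coordinates while reversing the
  multiplication exchanges the left and the right action.\<close>

lemma weak_bi_FP_opp:
  assumes "weak_bi_FP TYPE('k::comm_ring_1) TYPE('b::monoid_mult) n"
  shows "weak_bi_FP TYPE('k) TYPE('b opp) n"
proof -
  let ?h = "\<lambda>(c :: 'b opp, d :: 'b opp). (unopp d, unopp c)"
  have inj: "inj Opp" by (auto simp: inj_def)
  have l: "blact a (reindex ?h x) = reindex ?h (bract x (\<lambda>b. a (Opp b)))"
    for a and x :: "nat \<Rightarrow> 'b \<times> 'b \<Rightarrow> 'k"
    by (auto simp: fun_eq_iff reindex_def blact_apply bract_apply mr_mult_opp[of a])
  have r: "bract (reindex ?h x) a = reindex ?h (blact (\<lambda>b. a (Opp b)) x)"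
    for a and x :: "nat \<Rightarrow> 'b \<times> 'b \<Rightarrow> 'k"
    by (auto simp: fun_eq_iff reindex_def blact_apply bract_apply mr_mult_opp[of _ a])
  obtain r d and eps :: "(nat \<Rightarrow> 'b \<times> 'b \<Rightarrow> 'k) \<Rightarrow> 'k" where "FPn_resolution bi_ops n r d eps"
    using assms unfolding weak_bi_FP_def by blast
  then have "FPn_resolution bi_ops n r (\<lambda>i y. reindex ?h (d i (reindex (\<lambda>(c, d). (Opp d, Opp c)) y)))
      (\<lambda>y. eps (reindex (\<lambda>(c, d). (Opp d, Opp c)) y))"
  proof (rule FPn_resolution_reindex)
    fix T' :: "(nat \<Rightarrow> 'b opp \<times> 'b opp \<Rightarrow> 'k) \<Rightarrow> _" and s
    assume "(T', s) \<in> bi_ops"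
    then consider a where "fsupp a" "T' = blact a" "s = (\<lambda>k. aug a * k)"
      | a where "fsupp a" "T' = (\<lambda>x. bract x a)" "s = (\<lambda>k. k * aug a)"
      by (auto simp: bi_ops_def monoid_ring_def)
    then show "\<exists>T. (T, s) \<in> bi_ops \<and> (\<forall>x. T' (reindex ?h x) = reindex ?h (T x))"
    proof cases
      case 1
      \<comment> \<open>A left action turns into a right one, so the scalar must change sides; this
        uses that \<open>K\<close> is commutative and that \<open>Opp\<close> preserves the
        augmentation.\<close>
      have s_eq: "(\<lambda>k. aug a * k) = (\<lambda>k. k * aug (\<lambda>b. a (Opp b)))"
        by (simp add: aug_opp mult.commute fun_eq_iff)
      have "(\<lambda>x. bract x (\<lambda>b. a (Opp b)), s) \<in> bi_ops"
        unfolding bi_ops_def monoid_ring_def 1(3) s_eq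
        using fsupp_inj[OF 1(1) inj] by blast
      then show ?thesis using l 1(2) by blast
    next
      case 2
      have s_eq: "(\<lambda>k. k * aug a) = (\<lambda>k. aug (\<lambda>b. a (Opp b)) * k)"
        by (simp add: aug_opp mult.commute fun_eq_iff)
      have "(blact (\<lambda>b. a (Opp b)), s) \<in> bi_ops"
        unfolding bi_ops_def monoid_ring_def 2(3) s_eq
        using fsupp_inj[OF 2(1) inj] by blast
      then show ?thesis using r 2(2) by blast
    qed
  qed auto
  then show ?thesis unfolding weak_bi_FP_def by blast
qed

text \<open>Right modules over the monoid ring are left modules over that of the opposite monoid.
  There is one coordinate only, so relabelling by \<open>Opp\<close> suffices and nothing is
  swapped.\<close>

lemma right_FP_of_left_FP_opp:
  assumes "left_FP TYPE('k::comm_ring_1) TYPE('b::monoid_mult opp) n"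
  shows "right_FP TYPE('k) TYPE('b) n"
proof -
  have inj: "inj unopp" by (auto simp: inj_def intro: opp.expand)
  have r: "ract (reindex Opp x) a = reindex Opp (lact (\<lambda>b. a (unopp b)) x)"
    for a :: "'b \<Rightarrow> 'k" and x :: "nat \<Rightarrow> 'b opp \<Rightarrow> 'k"
    by (auto simp: fun_eq_iff reindex_def ract_def lact_def mr_mult_opp[of "\<lambda>b. a (unopp b)"])
  obtain r d and eps :: "(nat \<Rightarrow> 'b opp \<Rightarrow> 'k) \<Rightarrow> 'k" where "FPn_resolution left_ops n r d eps"
    using assms unfolding left_FP_def by blast
  then have "FPn_resolution right_ops n r (\<lambda>i y. reindex Opp (d i (reindex unopp y)))
      (\<lambda>y. eps (reindex unopp y))"
  proof (rule FPn_resolution_reindex)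
    fix T' :: "(nat \<Rightarrow> 'b \<Rightarrow> 'k) \<Rightarrow> _" and s
    assume "(T', s) \<in> right_ops"
    then obtain a where a: "fsupp a" "T' = (\<lambda>x. ract x a)" "s = (\<lambda>k. k * aug a)"
      by (auto simp: right_ops_def monoid_ring_def)
    have s_eq: "(\<lambda>k. k * aug a) = (\<lambda>k. aug (\<lambda>b. a (unopp b)) * k)"
      using aug_opp[of "\<lambda>b. a (unopp b)"] by (simp add: mult.commute fun_eq_iff)
    have "(lact (\<lambda>b. a (unopp b)), s) \<in> left_ops"
      unfolding left_ops_def monoid_ring_def a(3) s_eq
      using fsupp_inj[OF a(1) inj] by blast
    then show "\<exists>T. (T, s) \<in> left_ops \<and> (\<forall>x. T' (reindex Opp x) = reindex Opp (T x))"
      using r a(2) by blast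
  qed auto
  then show ?thesis unfolding right_FP_def by blast
qed

theorem theorem1:
  fixes n :: nat
  assumes "weak_bi_FP TYPE('k::comm_ring_1) TYPE('b::monoid_mult) n"
  shows "left_FP TYPE('k) TYPE('b) n \<and> right_FP TYPE('k) TYPE('b) n"
  using weak_bi_FP_imp_left_FP[OF assms]
    right_FP_of_left_FP_opp[OF weak_bi_FP_imp_left_FP[OF weak_bi_FP_opp[OF assms]]]
  by blast

end
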